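(* Let $Q$ be a prime power. For every propagation time $\rho\ge 2$ (an integer), every decision time $k_0\ge 1$ (an integer), and every integer $m\ge k_0+2$, there exists a cheating strategy for Alice in the $m$-round $\mathbb{F}_Q$ bit commitment protocol with propagation time $\rho$ and decision time $k_0$ whose cheating probability is at least $$1-\frac{1}{2}\left(\left(1-\frac{1}{Q}\right)\bigl(1-\omega(\mathrm{CHSH}_Q)\bigr)\right)^{\lfloor\frac{m-k_0-1}{\rho+1}\rfloor}.$$
   Context: $\mathbb{F}_Q$ is the finite field with $Q$ elements. The game $\mathrm{CHSH}_Q$: two non-communicating players receive independent uniform inputs $x,y\in\mathbb{F}_Q$ and output $a,b\in\mathbb{F}_Q$ respectively; they win iff $a+b=x\cdot y$. Its classical value is $\omega(\mathrm{CHSH}_Q)=\max_{s_1,s_2:\mathbb{F}_Q\to\mathbb{F}_Q}\Pr_{x,y}[s_1(x)+s_2(y)=xy]$. Cheating Alice in the $m$-round $\mathbb{F}_Q$ protocol with propagation time $\rho$ and decision time $k_0$: $d\in\{0,1\}$ (the bit to be revealed, viewed as an element of $\mathbb{F}_Q$) is uniform, $x_1,\dots,x_{m-1}\in\mathbb{F}_Q$ (Bob's messages in rounds $1,\dots,m-1$) are uniform, and all are independent. Alice has two agents, who answer odd and even rounds respectively. A cheating strategy is a tuple of functions $S=(s_1,\dots,s_m)$ with values in $\mathbb{F}_Q$, where the round-$i$ output $y_i$ is the value of $s_i$ on the information available at round $i$, namely: all $x_j$ with $1\le j\le \min(i,m-1)$ such that $j\le i-\rho$ (information that has propagated) or $j\equiv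 i \pmod 2$ (messages received by the same agent), together with $d$ if $i>k_0$ (the agents know which bit they want to reveal only after $k_0$ rounds). Set $\alpha_0:=d$ and $\alpha_i:=y_i-x_i\alpha_{i-1}$ for $1\le i\le m-1$. Alice succeeds iff $y_m=\alpha_{m-1}$, and the cheating probability of $S$ is $\Pr_{d,x_1,\dots,x_{m-1}}[y_m=\alpha_{m-1}]$. *)

theory Defs
  imports "HOL-Probability.Probability" "HOL-Probability.Product_PMF"
    "HOL-Number_Theory.Prime_Powers"
begin

definition chsh_win_prob :: "('a::{field,finite} \<Rightarrow> 'a) \<Rightarrow> ('a \<Rightarrow> 'a) \<Rightarrow> real" where
  "chsh_win_prob s1 s2 =
     measure_pmf.prob (pair_pmf (pmf_of_set UNIV) (pmf_of_set UNIV))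
       {(x, y). s1 x + s2 y = x * y}"

text \<open>The field is passed as a type, since it does not occur in the value.\<close>

definition chsh_value :: "'a::{field,finite} itself \<Rightarrow> real" where
  "chsh_value _ = Max {chsh_win_prob s1 s2 | s1 s2 :: 'a \<Rightarrow> 'a. True}"

text \<open>
  The information of the agent answering round \<open>i\<close>: a partial function giving exactly those of
  Bob's messages that the agent has, and the bit \<open>d\<close> if it is already decided. A strategy assigns
  to each round a function of this information, so the locality constraints hold by
  construction; only its values at the rounds \<open>1, \<dots>, m\<close> matter.
\<close>

type_synonym 'a info = "(nat \<rightharpoonup> 'a) \<times> 'a option"
type_synonym 'a strategy = "nat \<Rightarrow> 'a info \<Rightarrow> 'a"

definition visible_rounds :: "nat \<Rightarrow> nat \<Rightarrow> nat \<Rightarrow> nat set" where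
  "visible_rounds \<rho> m i =
     {j. 1 \<le> j \<and> j \<le> min i (m - 1) \<and> (j + \<rho> \<le> i \<or> j mod 2 = i mod 2)}"

definition info_at :: "nat \<Rightarrow> nat \<Rightarrow> nat \<Rightarrow> 'a \<Rightarrow> (nat \<Rightarrow> 'a) \<Rightarrow> nat \<Rightarrow> 'a info" where
  "info_at \<rho> k0 m d x i =
     ((\<lambda>j. if j \<in> visible_rounds \<rho> m i then Some (x j) else None),
      (if k0 < i then Some d else None))"

definition output_at ::
    "nat \<Rightarrow> nat \<Rightarrow> nat \<Rightarrow> 'a strategy \<Rightarrow> 'a \<Rightarrow> (nat \<Rightarrow> 'a) \<Rightarrow> nat \<Rightarrow> 'a" where
  "output_at \<rho> k0 m S d x i = S i (info_at \<rho> k0 m d x i)"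

primrec alpha :: "'a::field \<Rightarrow> (nat \<Rightarrow> 'a) \<Rightarrow> (nat \<Rightarrow> 'a) \<Rightarrow> nat \<Rightarrow> 'a" where
  "alpha d x y 0 = d"
| "alpha d x y (Suc i) = y (Suc i) - x (Suc i) * alpha d x y i"

definition cheating_succeeds ::
    "nat \<Rightarrow> nat \<Rightarrow> nat \<Rightarrow> 'a::field strategy \<Rightarrow> 'a \<Rightarrow> (nat \<Rightarrow> 'a) \<Rightarrow> bool" where
  "cheating_succeeds \<rho> k0 m S d x \<longleftrightarrow>
     (let y = output_at \<rho> k0 m S d x in y m = alpha d x y (m - 1))"

text \<open>
  \<open>Pi_pmf\<close> draws the messages \<open>x\<^sub>1, \<dots>, x\<^bsub>m-1\<^esub>\<close> independently; outside \<open>{1..m - 1}\<close> the function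
  \<open>x\<close> has the irrelevant default value \<open>0\<close>.
\<close>

definition cheating_prob :: "nat \<Rightarrow> nat \<Rightarrow> nat \<Rightarrow> 'a::{field,finite} strategy \<Rightarrow> real" where
  "cheating_prob \<rho> k0 m S =
     measure_pmf.prob
       (pair_pmf (pmf_of_set {0, 1}) (Pi_pmf {1..m - 1} 0 (\<lambda>_. pmf_of_set UNIV)))
       {(d, x). cheating_succeeds \<rho> k0 m S d x}"

end

theory Submission
  imports Defs
begin

text \<open>
  Alice answers 0 until the bit is decided, so afterwards \<open>\<alpha>\<close> is \<open>d\<close> times a product of the
  \<open>-x\<^sub>l\<close>. As soon as \<open>\<alpha>\<close> vanishes, answering 0 keeps it at 0 and wins; in particular \<open>d = 0\<close> always
  wins. For \<open>d = 1\<close> the later rounds are cut into blocks of length \<open>\<rho> + 1\<close>. In the last two rounds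
  of a block the answering agent knows the value \<open>c\<close> of \<open>\<alpha>\<close> at its start. With 0 as answer in the
  earlier rounds, \<open>\<alpha>\<close> after round \<open>\<rho>\<close> of the block is \<open>y + c X Y\<close>, where \<open>X\<close> and \<open>Y\<close> collect the
  messages to the agents of the last and of the last but one round. The answers \<open>y = - c g(Y)\<close> and then
  \<open>x c f(X)\<close> give \<open>\<alpha> = c x (f(X) + g(Y) - X Y)\<close> at the end of the block, which vanishes if
  \<open>x = 0\<close> or if \<open>(f, g)\<close> wins CHSH on the inputs \<open>X, Y\<close>.

  These inputs are not uniform. But CHSH is random self-reducible: shifting the inputs of an optimal
  pair of strategies by \<open>(p, q)\<close> and correcting the answers gives, for every fixed input and on
  average over \<open>(p, q)\<close>, winning probability \<open>\<omega>\<close>. Averaging over independent shifts for all blocks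
  shows that some fixed choice of shifts is good enough.
\<close>

section \<open>Random self-reducibility of CHSH\<close>

definition chsh_shift1 :: "('a::field \<Rightarrow> 'a) \<Rightarrow> 'a \<times> 'a \<Rightarrow> 'a \<Rightarrow> 'a" where
  "chsh_shift1 s r X = s (X + fst r) - X * snd r - fst r * snd r"

definition chsh_shift2 :: "('a::field \<Rightarrow> 'a) \<Rightarrow> 'a \<times> 'a \<Rightarrow> 'a \<Rightarrow> 'a" where
  "chsh_shift2 s r Y = s (Y + snd r) - fst r * Y"

text \<open>With \<open>r = (p, q)\<close>, the excess \<open>(X + p) * (Y + q) - X * Y\<close> is
  the sum of \<open>X * q + p * q\<close> and \<open>p * Y\<close>. Each summand is known to one
  player, who subtracts it.\<close>

lemma chsh_shift_wins_iff:
  "chsh_shift1 s1 r X + chsh_shift2 s2 r Y = X * Y \<longleftrightarrow>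
     s1 (X + fst r) + s2 (Y + snd r) = (X + fst r) * (Y + snd r)"
proof -
  have "chsh_shift1 s1 r X + chsh_shift2 s2 r Y - X * Y =
      s1 (X + fst r) + s2 (Y + snd r) - (X + fst r) * (Y + snd r)"
    by (simp add: chsh_shift1_def chsh_shift2_def algebra_simps)
  then show ?thesis
    by (metis eq_iff_diff_eq_0)
qed

lemma chsh_win_prob_card:
  "chsh_win_prob s1 s2 =
     card {(x, y). s1 x + s2 y = x * y} / (real CARD('a))\<^sup>2"
  for s1 s2 :: "'a::{field,finite} \<Rightarrow> 'a"
proof -
  have "pair_pmf (pmf_of_set (UNIV :: 'a set)) (pmf_of_set (UNIV :: 'a set)) = pmf_of_set UNIV"
    by (rule pmf_eqI) (auto simp: pmf_pair)
  then show ?thesis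
    by (simp add: chsh_win_prob_def measure_pmf_of_set power2_eq_square)
qed

text \<open>For fixed inputs, the shifted pair runs through all input pairs exactly once as
  \<open>r\<close> varies, so losing shifts correspond to losing inputs of
  \<open>(s1, s2)\<close>.\<close>

lemma card_chsh_shift_losing:
  "real (card {r. chsh_shift1 s1 r X + chsh_shift2 s2 r Y \<noteq> X * Y}) =
     (real CARD('a))\<^sup>2 * (1 - chsh_win_prob s1 s2)"
  for s1 s2 :: "'a::{field,finite} \<Rightarrow> 'a"
proof -
  let ?W = "{(x, y). s1 x + s2 y = x * y}"
  let ?t = "\<lambda>r. (X + fst r, Y + snd r)"
  have "bij_betw ?t {r. chsh_shift1 s1 r X + chsh_shift2 s2 r Y \<noteq> X * Y} (- ?W)"
    by (rule bij_betwI[where g = "\<lambda>r. (fst r - X, snd r - Y)"])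
      (auto simp: chsh_shift_wins_iff)
  then have "card {r. chsh_shift1 s1 r X + chsh_shift2 s2 r Y \<noteq> X * Y} = card (- ?W)"
    by (rule bij_betw_same_card)
  also have "real \<dots> = (real CARD('a))\<^sup>2 - card ?W"
    by (simp add: Compl_eq_Diff_UNIV card_Diff_subset of_nat_diff card_mono power2_eq_square
        flip: of_nat_mult card_prod)
  finally show ?thesis
    by (simp add: chsh_win_prob_card right_diff_distrib)
qed

lemma chsh_value_attained:
  obtains s1 s2 :: "'a::{field,finite} \<Rightarrow> 'a" where "chsh_win_prob s1 s2 = chsh_value TYPE('a)"
proof -
  have eq: "{chsh_win_prob s1 s2 | s1 s2 :: 'a \<Rightarrow> 'a. True} =
      range (\<lambda>(s1, s2 :: 'a \<Rightarrow> 'a). chsh_win_prob s1 s2)"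
    by auto
  have "chsh_value TYPE('a) \<in> range (\<lambda>(s1, s2 :: 'a \<Rightarrow> 'a). chsh_win_prob s1 s2)"
    unfolding chsh_value_def eq by (rule Max_in) auto
  then show ?thesis
    using that by auto
qed

section \<open>The block strategy and its effect on \<alpha>\<close>

lemma alpha_zero_outputs:
  assumes "\<And>l. i < l \<Longrightarrow> l \<le> i + t \<Longrightarrow> y l = 0"
  shows "alpha d x y (i + t) = alpha d x y i * (\<Prod>l\<in>{i<..i+t}. - x l)"
  using assms
proof (induction t)
  case (Suc t)
  have "{i<..i + Suc t} = insert (i + Suc t) {i<..i+t}"
    by auto
  then show ?case
    using Suc by simp
qed simp

locale block_strategy =
  fixes \<rho> k0 n :: nat and s1 s2 :: "'a::{field,finite} \<Rightarrow> 'a" and R :: "nat \<Rightarrow> 'a \<times> 'a"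
  assumes \<rho>_pos: "\<rho> > 0"
begin

text \<open>Blocks are counted from 0, and \<open>start b\<close> is the round just before block
  \<open>b\<close>, which ends with round \<open>start (Suc b)\<close>.\<close>

definition start :: "nat \<Rightarrow> nat" where
  "start b = k0 + b * (\<rho> + 1)"

text \<open>Round \<open>start b + \<rho>\<close> is the last but one of the block, so its parity
  separates the two agents. The message of the last round is left out of both products and becomes a
  factor of \<open>A\<close>.\<close>

definition X :: "(nat \<Rightarrow> 'a) \<Rightarrow> nat \<Rightarrow> 'a" where
  "X x b = (\<Prod>l | l \<in> {start b<..start b + \<rho>} \<and> l mod 2 \<noteq> (start b + \<rho>) mod 2. - x l)"

definition Y :: "(nat \<Rightarrow> 'a) \<Rightarrow> nat \<Rightarrow> 'a" where
  "Y x b = (\<Prod>l | l \<in> {start b<..start b + \<rho>} \<and> l mod 2 = (start b + \<rho>) mod 2. - x l)"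

abbreviation f :: "(nat \<Rightarrow> 'a) \<Rightarrow> nat \<Rightarrow> 'a" where
  "f x b \<equiv> chsh_shift1 s1 (R b) (X x b)"

abbreviation g :: "(nat \<Rightarrow> 'a) \<Rightarrow> nat \<Rightarrow> 'a" where
  "g x b \<equiv> chsh_shift2 s2 (R b) (Y x b)"

text \<open>This predicts \<alpha> at \<open>start b\<close> from \<open>d\<close> and the messages
  alone, so that \<open>out\<close> can use it without recursion through earlier outputs.\<close>

primrec A :: "'a \<Rightarrow> (nat \<Rightarrow> 'a) \<Rightarrow> nat \<Rightarrow> 'a" where
  "A d x 0 = d * (\<Prod>l\<in>{0<..k0}. - x l)"
| "A d x (Suc b) = A d x b * x (start (Suc b)) * (f x b + g x b - X x b * Y x b)"

definition out :: "'a \<Rightarrow> (nat \<Rightarrow> 'a) \<Rightarrow> nat \<Rightarrow> 'a" where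
  "out d x i =
     (if i \<le> k0 then 0 else
      let b = (i - k0 - 1) div (\<rho> + 1); r = (i - k0 - 1) mod (\<rho> + 1) in
      if n \<le> b then 0
      else if r = \<rho> - 1 then - A d x b * g x b
      else if r = \<rho> then A d x b * x i * f x b
      else 0)"

text \<open>Missing data are read as 0 and fed to \<open>out\<close>, which is defined with full
  information; \<open>output_at_S\<close> shows that no answer is affected.\<close>

definition S :: "'a strategy" where
  "S i h = out (case snd h of None \<Rightarrow> 0 | Some d \<Rightarrow> d)
     (\<lambda>l. case fst h l of None \<Rightarrow> 0 | Some v \<Rightarrow> v) i"

lemma start_Suc: "start (Suc b) = Suc (start b + \<rho>)"
  by (simp add: start_def)

lemma start_mono: "b \<le> b' \<Longrightarrow> start b \<le> start b'"
  unfolding start_def by (intro add_left_mono mult_le_mono1)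

lemma X_cong:
  assumes "\<And>l. start b < l \<Longrightarrow> l \<le> start b + \<rho> \<Longrightarrow> l mod 2 \<noteq> (start b + \<rho>) mod 2 \<Longrightarrow> x l = x' l"
  shows "X x b = X x' b"
  unfolding X_def using assms by (intro prod.cong) auto

lemma Y_cong:
  assumes "\<And>l. start b < l \<Longrightarrow> l \<le> start b + \<rho> \<Longrightarrow> l mod 2 = (start b + \<rho>) mod 2 \<Longrightarrow> x l = x' l"
  shows "Y x b = Y x' b"
  unfolding Y_def using assms by (intro prod.cong) auto

lemma XY: "X x b * Y x b = (\<Prod>l\<in>{start b<..start b + \<rho>}. - x l)"
proof -
  have "(\<Prod>l\<in>{start b<..start b + \<rho>}. - x l) =
      (\<Prod>l\<in>{l \<in> {start b<..start b + \<rho>}. l mod 2 \<noteq> (start b + \<rho>) mod 2} \<union>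
        {l \<in> {start b<..start b + \<rho>}. l mod 2 = (start b + \<rho>) mod 2}. - x l)"
    by (rule prod.cong) auto
  also have "\<dots> = X x b * Y x b"
    unfolding X_def Y_def by (rule prod.union_disjoint) auto
  finally show ?thesis ..
qed

lemma A_cong:
  assumes "\<And>l. 0 < l \<Longrightarrow> l \<le> start b \<Longrightarrow> x l = x' l"
  shows "A d x b = A d x' b"
  using assms
proof (induction b)
  case 0
  then have "(\<Prod>l\<in>{0<..k0}. - x l) = (\<Prod>l\<in>{0<..k0}. - x' l)"
    by (intro prod.cong) (auto simp: start_def)
  then show ?case by simp
next
  case (Suc b)
  have "A d x b = A d x' b" "X x b = X x' b" "Y x b = Y x' b"
    by (intro Suc.IH X_cong Y_cong Suc.prems; simp add: start_Suc)+
  moreover have "x (start (Suc b)) = x' (start (Suc b))"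
    by (intro Suc.prems) (simp_all add: start_Suc)
  ultimately show ?case by simp
qed

lemma out_within_block:
  assumes "r \<le> \<rho>"
  shows "out d x (Suc (start b + r)) =
      (if n \<le> b then 0
       else if r = \<rho> - 1 then - A d x b * g x b
       else if r = \<rho> then A d x b * x (Suc (start b + r)) * f x b
       else 0)"
proof -
  have eq: "Suc (start b + r) - k0 - 1 = b * (\<rho> + 1) + r"
    by (simp add: start_def)
  have "(b * (\<rho> + 1) + r) div (\<rho> + 1) = b" "(b * (\<rho> + 1) + r) mod (\<rho> + 1) = r"
    using assms by (simp_all add: div_mult_self3 del: mult_Suc_right)
  then show ?thesis
    unfolding out_def eq by (simp add: start_def)
qed

lemma round_in_block:
  assumes "k0 < i"
  obtains b r where "i = Suc (start b + r)" "r \<le> \<rho>"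
proof
  let ?t = "i - k0 - 1"
  have "?t = ?t div (\<rho> + 1) * (\<rho> + 1) + ?t mod (\<rho> + 1)"
    by (rule div_mult_mod_eq[symmetric])
  then show "i = Suc (start (?t div (\<rho> + 1)) + ?t mod (\<rho> + 1))"
    using assms unfolding start_def by linarith
  show "?t mod (\<rho> + 1) \<le> \<rho>"
    using mod_less_divisor[of "\<rho> + 1" ?t] by linarith
qed

lemma alpha_out_start:
  "b \<le> n \<Longrightarrow> alpha d x (out d x) (start b) = A d x b"
proof (induction b)
  case 0
  have "out d x l = 0" if "l \<le> k0" for l
    using that by (simp add: out_def)
  then show ?case
    using alpha_zero_outputs[of 0 k0 "out d x" d x] by (simp add: start_def)
next
  case (Suc b)
  let ?\<alpha> = "alpha d x (out d x)" and ?j = "start b"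
  obtain \<rho>' where \<rho>': "\<rho>' < \<rho>" "\<rho>' = \<rho> - 1" and last: "?j + \<rho> = Suc (?j + \<rho>')"
    using \<rho>_pos by (cases \<rho>) auto
  have zero: "out d x l = 0" if "?j < l" "l \<le> ?j + \<rho>'" for l
  proof -
    define r where "r = l - ?j - 1"
    have "l = Suc (?j + r)" "r < \<rho>'"
      using that by (auto simp: r_def)
    then show ?thesis
      using out_within_block[of r d x b] \<rho>' by auto
  qed
  have "{?j<..?j + \<rho>} = insert (Suc (?j + \<rho>')) {?j<..?j + \<rho>'}"
    using \<rho>' by auto
  then have XY': "X x b * Y x b = - x (Suc (?j + \<rho>')) * (\<Prod>l\<in>{?j<..?j + \<rho>'}. - x l)"
    unfolding XY by simp
  have "?\<alpha> (?j + \<rho>') = A d x b * (\<Prod>l\<in>{?j<..?j + \<rho>'}. - x l)"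
    using alpha_zero_outputs[of ?j \<rho>' "out d x" d x] zero Suc by simp
  \<comment> \<open>The first \<open>\<rho> - 1\<close> answers are 0; the answer
    \<open>- A d x b * g x b\<close> then adds to the full product of the block's first \<rho>
    factors.\<close>
  then have "?\<alpha> (?j + \<rho>) = A d x b * (X x b * Y x b - g x b)"
    using out_within_block[of \<rho>' d x b, folded last] Suc.prems \<rho>' XY'
    unfolding last alpha.simps by (auto simp: last algebra_simps)
  moreover have "out d x (Suc (?j + \<rho>)) = A d x b * x (Suc (?j + \<rho>)) * f x b"
    using out_within_block[of \<rho> d x b] Suc.prems \<rho>_pos by auto
  ultimately have "?\<alpha> (Suc (?j + \<rho>)) =
      A d x b * x (Suc (?j + \<rho>)) * (f x b + g x b - X x b * Y x b)"
    by (simp only: alpha.simps) (simp add: algebra_simps)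
  then show ?case
    by (simp only: start_Suc A.simps)
qed

text \<open>Nonzero answers occur only in the last two rounds of a block. By then every message up
  to \<open>start b\<close>, hence \<open>A d x b\<close>, has propagated, and the messages in
  \<open>Y\<close> or \<open>X\<close> went to the answering agent itself.\<close>

lemma output_at_S:
  assumes "start n < m"
  shows "output_at \<rho> k0 m S d x i = out d x i"
proof (cases "k0 < i")
  case True
  obtain b r where i: "i = Suc (start b + r)" and r: "r \<le> \<rho>"
    using round_in_block[OF True] .
  define x' where "x' l = (if l \<in> visible_rounds \<rho> m i then x l else 0)" for l
  have "output_at \<rho> k0 m S d x i = out d x' i"
    using True unfolding output_at_def S_def info_at_def x'_def
    by (auto intro!: arg_cong[where f = "\<lambda>x. out d x i"])
  also have "\<dots> = out d x i"
  proof (cases "b < n \<and> (r = \<rho> - 1 \<or> r = \<rho>)")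
    case True
    \<comment> \<open>This makes the cap \<open>m - 1\<close> in \<open>visible_rounds\<close>
      harmless, so the message of round \<open>i\<close> itself is visible.\<close>
    have "i < m"
      using True i r assms start_mono[of "Suc b" n] start_Suc[of b] by simp
    then have x': "x' l = x l" if "0 < l" "l \<le> i" "l + \<rho> \<le> i \<or> l mod 2 = i mod 2" for l
      using that by (auto simp: x'_def visible_rounds_def)
    have "A d x' b = A d x b"
      using True i \<rho>_pos by (intro A_cong x') auto
    moreover have "Y x' b = Y x b" if "r = \<rho> - 1"
      using that i \<rho>_pos by (intro Y_cong x') auto
    moreover have "X x' b = X x b" if "r = \<rho>"
    proof (intro X_cong x')
      fix l assume "l mod 2 \<noteq> (start b + \<rho>) mod 2"
      then show "l + \<rho> \<le> i \<or> l mod 2 = i mod 2"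
        unfolding i that by presburger
    qed (use that i in auto)
    moreover have "x' i = x i"
      using i by (intro x') auto
    ultimately show ?thesis
      using out_within_block[OF r, of d _ b, folded i] by auto
  next
    case False
    then show ?thesis
      using out_within_block[OF r, of d _ b, folded i] by auto
  qed
  finally show ?thesis .
next
  case False
  then show ?thesis
    by (simp add: output_at_def S_def out_def)
qed

lemma A_nonzero:
  "A d x b \<noteq> 0 \<Longrightarrow> b' < b \<Longrightarrow> x (start (Suc b')) \<noteq> 0 \<and> f x b' + g x b' \<noteq> X x b' * Y x b'"
  by (induction b) (auto simp: less_Suc_eq)

lemma A_zero: "A 0 x b = 0"
  by (induction b) auto

text \<open>After round \<open>start n\<close> all answers are 0, including the one in round
  \<open>m\<close>. Failure thus means that the final \<alpha>, a multiple of
  \<open>A d x n\<close>, is nonzero, and then so is every factor of \<open>A d x n\<close>.\<close>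

lemma cheating_fails:
  assumes "start n < m" "\<not> cheating_succeeds \<rho> k0 m S d x"
  shows "d \<noteq> 0"
    and "\<And>b. b < n \<Longrightarrow> x (start (Suc b)) \<noteq> 0 \<and> f x b + g x b \<noteq> X x b * Y x b"
proof -
  have "output_at \<rho> k0 m S d x = out d x"
    using output_at_S[OF assms(1)] by auto
  moreover have zero: "out d x l = 0" if "start n < l" for l
  proof -
    have "k0 < l"
      using that by (simp add: start_def)
    then obtain b r where l: "l = Suc (start b + r)" "r \<le> \<rho>"
      using round_in_block by blast
    have "n \<le> b"
      using that l start_mono[of "Suc b" n] start_Suc[of b] by (force simp: not_le[symmetric])
    then show ?thesis
      using out_within_block l by simp
  qed
  moreover have "alpha d x (out d x) (start n + (m - 1 - start n)) =
      A d x n * (\<Prod>l\<in>{start n<..start n + (m - 1 - start n)}. - x l)"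
    using alpha_zero_outputs[of "start n" "m - 1 - start n" "out d x" d x] zero alpha_out_start[of n]
    by simp
  ultimately have "A d x n \<noteq> 0"
    using assms by (auto simp: cheating_succeeds_def)
  then show "d \<noteq> 0" and "\<And>b. b < n \<Longrightarrow> x (start (Suc b)) \<noteq> 0 \<and> f x b + g x b \<noteq> X x b * Y x b"
    using A_zero A_nonzero by auto
qed

end

section \<open>Averaging over shifts and independence of messages\<close>

lemma derandomize:
  fixes L :: "nat \<Rightarrow> 'r::finite \<Rightarrow> 'x \<Rightarrow> real" and M :: "'x pmf"
  assumes fin: "finite (set_pmf M)"
    and mean: "\<And>b x. b < n \<Longrightarrow> (\<Sum>r\<in>UNIV. L b r x) = real CARD('r) * p * w b x"
  shows "\<exists>R. measure_pmf.expectation M (\<lambda>x. \<Prod>b<n. L b (R b) x) \<le>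
    p ^ n * measure_pmf.expectation M (\<lambda>x. \<Prod>b<n. w b x)"
proof (rule ccontr)
  let ?E = "measure_pmf.expectation M"
  \<comment> \<open>Only the first \<open>n\<close> values of \<open>R\<close> matter; extensional
    functions make the set of choices finite.\<close>
  let ?P = "PiE {..<n} (\<lambda>_. UNIV :: 'r set)"
  assume "\<not> ?thesis"
  then have less: "p ^ n * ?E (\<lambda>x. \<Prod>b<n. w b x) < ?E (\<lambda>x. \<Prod>b<n. L b (R b) x)" for R
    by (auto simp: not_le)
  have fin': "finite ?P"
    by (simp add: finite_PiE)
  have "real (card ?P) * (p ^ n * ?E (\<lambda>x. \<Prod>b<n. w b x)) =
      (\<Sum>R\<in>?P. p ^ n * ?E (\<lambda>x. \<Prod>b<n. w b x))"
    by simp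
  also have "\<dots> < (\<Sum>R\<in>?P. ?E (\<lambda>x. \<Prod>b<n. L b (R b) x))"
    using fin' less by (intro sum_strict_mono) (auto simp: PiE_eq_empty_iff)
  also have "\<dots> = ?E (\<lambda>x. \<Sum>R\<in>?P. \<Prod>b<n. L b (R b) x)"
    by (rule Bochner_Integration.integral_sum[symmetric])
      (rule integrable_measure_pmf_finite[OF fin])
  \<comment> \<open>Since the shifts are independent, the sum factorises for each fixed
    \<open>x\<close>, and \<open>mean\<close> applies block by block.\<close>
  also have "(\<lambda>x. \<Sum>R\<in>?P. \<Prod>b<n. L b (R b) x) = (\<lambda>x. \<Prod>b<n. \<Sum>r\<in>UNIV. L b r x)"
    by (intro ext prod_sum_PiE[symmetric]) auto
  also have "\<dots> = (\<lambda>x. (real CARD('r) * p) ^ n * (\<Prod>b<n. w b x))"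
    by (intro ext) (simp add: mean prod.distrib mult_ac power_mult_distrib)
  also have "?E \<dots> = real (card ?P) * (p ^ n * ?E (\<lambda>x. \<Prod>b<n. w b x))"
    by (simp add: card_PiE power_mult_distrib)
  finally show False
    by simp
qed

lemma prob_uniform_messages_nonzero:
  fixes J :: "'i set"
  assumes "finite I" "J \<subseteq> I"
  shows "measure_pmf.prob (Pi_pmf I 0 (\<lambda>_. pmf_of_set (UNIV :: 'a::{zero,finite} set)))
      {x. \<forall>j\<in>J. x j \<noteq> 0} = (1 - 1 / real CARD('a)) ^ card J"
proof -
  have "{x. \<forall>j\<in>J. x j \<noteq> 0} = Pi I (\<lambda>j. if j \<in> J then - {0 :: 'a} else UNIV)"
    using assms(2) by (auto simp: Pi_def)
  moreover have "measure_pmf.prob (pmf_of_set (UNIV :: 'a set)) (- {0}) = 1 - 1 / real CARD('a)"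
    by (simp add: measure_pmf_of_set Compl_eq_Diff_UNIV card_Diff_subset of_nat_diff diff_divide_distrib)
  ultimately have "measure_pmf.prob (Pi_pmf I 0 (\<lambda>_. pmf_of_set (UNIV :: 'a set)))
      {x. \<forall>j\<in>J. x j \<noteq> 0} = (\<Prod>j\<in>I. if j \<in> J then 1 - 1 / real CARD('a) else 1)"
    using assms(1)
    by (simp add: measure_Pi_pmf_Pi if_distrib[of "measure_pmf.prob _"] cong: if_cong)
  also have "\<dots> = (1 - 1 / real CARD('a)) ^ card J"
    using assms by (simp add: prod.If_cases Int_absorb1)
  finally show ?thesis .
qed

section \<open>The bound on the cheating probability\<close>

theorem theorem3:
  fixes Q \<rho> k0 m :: nat
  assumes "primepow Q"
    and "CARD('a::{field,finite}) = Q"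
    and "\<rho> \<ge> 2" and "k0 \<ge> 1" and "m \<ge> k0 + 2"
  shows "\<exists>S :: 'a strategy.
    cheating_prob \<rho> k0 m S \<ge>
      1 - 1 / 2 * ((1 - 1 / real Q) * (1 - chsh_value TYPE('a))) ^ ((m - k0 - 1) div (\<rho> + 1))"
proof -
  define n where "n = (m - k0 - 1) div (\<rho> + 1)"
  obtain s1 s2 :: "'a \<Rightarrow> 'a" where \<omega>: "chsh_win_prob s1 s2 = chsh_value TYPE('a)"
    by (rule chsh_value_attained)
  define j where "j b = block_strategy.start \<rho> k0 (Suc b)" for b
  define X where "X = (block_strategy.X \<rho> k0 :: (nat \<Rightarrow> 'a) \<Rightarrow> nat \<Rightarrow> 'a)"
  define Y where "Y = (block_strategy.Y \<rho> k0 :: (nat \<Rightarrow> 'a) \<Rightarrow> nat \<Rightarrow> 'a)"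
  \<comment> \<open>Block \<open>b\<close> is bad if neither event that would make \<alpha> vanish
    at its end occurs: a zero last message or a CHSH win.\<close>
  define bad where "bad b r x \<longleftrightarrow> x (j b) \<noteq> 0 \<and>
    chsh_shift1 s1 r (X x b) + chsh_shift2 s2 r (Y x b) \<noteq> X x b * Y x b" for b r x
  define P where "P = (Pi_pmf {1..m - 1} 0 (\<lambda>_. pmf_of_set UNIV) :: (nat \<Rightarrow> 'a) pmf)"
  define w where "w b x = (of_bool (x (j b) \<noteq> 0) :: real)" for b and x :: "nat \<Rightarrow> 'a"
  have fin: "finite (set_pmf P)"
    unfolding P_def by (simp add: set_Pi_pmf finite_PiE_dflt)
  have block: "block_strategy \<rho>"
    using assms(3) by unfold_locales simp
  have j: "j b = k0 + Suc b * (\<rho> + 1)" for b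
    by (simp add: j_def block_strategy.start_def[OF block])
  have n: "n * (\<rho> + 1) \<le> m - k0 - 1"
    unfolding n_def by (rule div_times_less_eq_dividend)
  have j_in: "j ` {..<n} \<subseteq> {1..m - 1}"
  proof safe
    fix b assume "b < n"
    then have "Suc b * (\<rho> + 1) \<le> n * (\<rho> + 1)"
      by (intro mult_le_mono) auto
    then show "j b \<in> {1..m - 1}"
      using n assms(4,5) unfolding j atLeastAtMost_iff by linarith
  qed
  \<comment> \<open>Distinct last rounds give \<open>n\<close> independent messages, hence the power
    of \<open>1 - 1 / real Q\<close>.\<close>
  have "inj j"
    unfolding j inj_on_def by (metis add_left_cancel mult_cancel2 old.nat.inject add_is_0 one_neq_zero)
  then have card_j: "card (j ` {..<n}) = n"
    by (simp add: card_image inj_on_subset)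
  have expectation_of_bool: "measure_pmf.expectation P (\<lambda>x. \<Prod>b<n. of_bool (B b x)) =
      measure_pmf.prob P {x. \<forall>b<n. B b x}" for B
  proof -
    have "(\<lambda>x. \<Prod>b<n. of_bool (B b x)) = indicat_real {x. \<forall>b<n. B b x}"
      by (intro ext) (auto simp: indicator_def)
    then show ?thesis
      by simp
  qed
  have mean: "(\<Sum>r\<in>UNIV. of_bool (bad b r x)) =
      real CARD('a \<times> 'a) * (1 - chsh_value TYPE('a)) * w b x" for b x
    using card_chsh_shift_losing[of s1 "X x b" s2 "Y x b"]
    by (simp add: bad_def w_def \<omega> power2_eq_square of_bool_def sum.If_cases)
  obtain R where
    "measure_pmf.expectation P (\<lambda>x. \<Prod>b<n. of_bool (bad b (R b) x)) \<le>
      (1 - chsh_value TYPE('a)) ^ n * measure_pmf.expectation P (\<lambda>x. \<Prod>b<n. w b x)"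
    using derandomize[where L = "\<lambda>b r x. of_bool (bad b r x)" and w = w, OF fin mean] by blast
  moreover have "{x. \<forall>b<n. x (j b) \<noteq> (0 :: 'a)} = {x. \<forall>i\<in>j ` {..<n}. x i \<noteq> 0}"
    by auto
  then have "measure_pmf.prob P {x. \<forall>b<n. x (j b) \<noteq> 0} = (1 - 1 / real Q) ^ n"
    using prob_uniform_messages_nonzero[of "{1..m - 1}" "j ` {..<n}", where 'a = 'a] j_in
    by (simp only: card_j assms(2) P_def finite_atLeastAtMost)
  ultimately have R: "measure_pmf.prob P {x. \<forall>b<n. bad b (R b) x} \<le>
      ((1 - 1 / real Q) * (1 - chsh_value TYPE('a))) ^ n"
    by (simp add: w_def expectation_of_bool power_mult_distrib mult.commute)
  let ?S = "block_strategy.S \<rho> k0 n s1 s2 R"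
  let ?D = "pair_pmf (pmf_of_set {0, 1 :: 'a}) P"
  let ?F = "{(d, x). \<not> cheating_succeeds \<rho> k0 m ?S d x}"
  have "block_strategy.start \<rho> k0 n < m"
    using n assms(5) unfolding block_strategy.start_def[OF block] by linarith
  note fails = block_strategy.cheating_fails[OF block this, of s1 s2 R]
  \<comment> \<open>Restricting to the support forces \<open>d\<close> into \<open>{0, 1}\<close>,
    so failure leaves only \<open>d = 1\<close>, and gives the countability required by the product
    formula.\<close>
  have "?F \<inter> set_pmf ?D \<subseteq> {1} \<times> ({x. \<forall>b<n. bad b (R b) x} \<inter> set_pmf P)"
  proof safe
    fix d x assume *: "\<not> cheating_succeeds \<rho> k0 m ?S d x" and **: "(d, x) \<in> set_pmf ?D"
    show "d = 1"
      using fails(1)[OF *] ** by auto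
    show "bad b (R b) x" if "b < n" for b
      using fails(2)[OF * that] by (simp add: bad_def j_def X_def Y_def)
    show "x \<in> set_pmf P"
      using ** by auto
  qed
  then have "measure_pmf.prob ?D (?F \<inter> set_pmf ?D) \<le>
      measure_pmf.prob ?D ({1} \<times> ({x. \<forall>b<n. bad b (R b) x} \<inter> set_pmf P))"
    by (intro measure_pmf.finite_measure_mono) auto
  also have "\<dots> = measure_pmf.prob (pmf_of_set {0, 1 :: 'a}) {1} *
      measure_pmf.prob P ({x. \<forall>b<n. bad b (R b) x} \<inter> set_pmf P)"
    by (rule measure_pmf_prob_product) (auto intro: countable_Int2)
  also have "\<dots> = 1 / 2 * measure_pmf.prob P {x. \<forall>b<n. bad b (R b) x}"
    by (simp add: measure_pmf_of_set measure_Int_set_pmf)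
  finally have "measure_pmf.prob ?D ?F \<le>
      1 / 2 * ((1 - 1 / real Q) * (1 - chsh_value TYPE('a))) ^ n"
    using R unfolding measure_Int_set_pmf by linarith
  moreover have "cheating_prob \<rho> k0 m ?S = 1 - measure_pmf.prob ?D ?F"
  proof -
    have "{(d, x). cheating_succeeds \<rho> k0 m ?S d x} = space (measure_pmf ?D) - ?F"
      by auto
    then show ?thesis
      unfolding cheating_prob_def P_def[symmetric]
      by (simp only: measure_pmf.prob_compl sets_measure_pmf UNIV_I)
  qed
  ultimately show ?thesis
    unfolding n_def[symmetric] by (intro exI[of _ ?S]) linarith
qed

end
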